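(* Let $G$ be a graph with edge set $E(G)=\{e_1,\dots,e_m\}$ such that $\operatorname{Cut}^{\Box}(G)$ is normal and Gorenstein, and let $\mathbf{x}\in\operatorname{int}(M_G)$ be the generator of the canonical module, i.e. $\operatorname{int}(M_G)=\mathbf{x}+M_G$. Then (i) $\mathbf{x}=(1,1,\dots,1,2)\in\mathbb{Z}^{m+1}$ if $G$ is a bipartite graph without induced cycle of length greater than or equal to $6$, and (ii) $\mathbf{x}=(2,2,\dots,2,4)\in\mathbb{Z}^{m+1}$ if $G$ is a bridgeless chordal graph.
   Context: For $G=(V,E)$ and $A\subseteq V$ the cut vector $\delta_A\in\mathbb{R}^E$ has $\delta_{A,e}=1$ if $|A\cap e|=1$ and $0$ otherwise; $\operatorname{Cut}^{\Box}(G)=\operatorname{conv}\{\delta_A\}$, and $M_G\subseteq\mathbb{Z}^{m}\times\mathbb{Z}$ is the affine monoid generated by the vectors $(\delta_A,1)$, $A\subseteq V$ (coordinates indexed by $e_1,\dots,e_m$, then the last coordinate). For an affine monoid $M$, $\operatorname{int}(M)=M\cap\operatorname{relint}(\operatorname{cone}(M))$, where $\operatorname{cone}(M)$ is the real cone generated by $M$. The cut polytope is normal if $M_G$ is normal (every $x\in\operatorname{gp}(M_G)$ with some positive multiple in $M_G$ lies in $M_G$); for normal $M_G$, the canonical module of $\mathbb{K}[M_G]$ is the ideal spanned by the monomials of $\operatorname{int}(M_G)$, and $\mathbb{K}[M_G]$ is Gorenstein iff $\operatorname{int}(M_G)=\mathbf{x}+M_G$ for some $\mathbf{x}\in\operatorname{int}(M_G)$,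 called the generator. A graph is chordal if all its induced cycles are triangles; an edge is a bridge if it lies on no cycle; bridgeless means having no bridge. *)

theory Defs
  imports "HOL-Analysis.Analysis" "HOL-Computational_Algebra.Group_Closure"
begin

subsection \<open>Finite simple graphs\<close>

definition simple_graph :: "'a set \<Rightarrow> 'a set set \<Rightarrow> bool" where
  "simple_graph V E \<longleftrightarrow> finite V \<and> (\<forall>d\<in>E. d \<subseteq> V \<and> card d = 2)"

definition bipartite_graph :: "'a set \<Rightarrow> 'a set set \<Rightarrow> bool" where
  "bipartite_graph V E \<longleftrightarrow>
     (\<exists>X Y. X \<union> Y = V \<and> X \<inter> Y = {} \<and> (\<forall>d\<in>E. \<exists>u\<in>X. \<exists>v\<in>Y. d = {u, v}))"

text \<open>A cycle is given by the list of its vertices in cyclic order; its length is the length of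
  the list.\<close>

definition cycle_edges :: "'a list \<Rightarrow> 'a set set" where
  "cycle_edges vs = {{vs ! i, vs ! (Suc i mod length vs)} | i. i < length vs}"

definition is_cycle :: "'a set set \<Rightarrow> 'a list \<Rightarrow> bool" where
  "is_cycle E vs \<longleftrightarrow> 3 \<le> length vs \<and> distinct vs \<and> cycle_edges vs \<subseteq> E"

definition induced_cycle :: "'a set set \<Rightarrow> 'a list \<Rightarrow> bool" where
  "induced_cycle E vs \<longleftrightarrow> is_cycle E vs \<and> {d \<in> E. d \<subseteq> set vs} = cycle_edges vs"

definition chordal_graph :: "'a set set \<Rightarrow> bool" where
  "chordal_graph E \<longleftrightarrow> (\<forall>vs. induced_cycle E vs \<longrightarrow> length vs = 3)"

definition is_bridge :: "'a set set \<Rightarrow> 'a set \<Rightarrow> bool" where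
  "is_bridge E d \<longleftrightarrow> d \<in> E \<and> \<not> (\<exists>vs. is_cycle E vs \<and> d \<in> cycle_edges vs)"

definition bridgeless :: "'a set set \<Rightarrow> bool" where
  "bridgeless E \<longleftrightarrow> \<not> (\<exists>d. is_bridge E d)"


subsection \<open>Affine monoids\<close>

inductive_set monoid_closure :: "'b::comm_monoid_add set \<Rightarrow> 'b set" for S where
  zero: "0 \<in> monoid_closure S"
| base: "s \<in> S \<Longrightarrow> s \<in> monoid_closure S"
| add: "s \<in> monoid_closure S \<Longrightarrow> t \<in> monoid_closure S \<Longrightarrow> s + t \<in> monoid_closure S"

text \<open>Lattice points are regarded as points of the ambient real vector space, in which cones
  and relative interiors are taken.\<close>

definition normal_monoid :: "'b::real_vector set \<Rightarrow> bool" where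
  "normal_monoid M \<longleftrightarrow>
     (\<forall>x\<in>group_closure M. (\<exists>n::nat. n > 0 \<and> real n *\<^sub>R x \<in> M) \<longrightarrow> x \<in> M)"

definition monoid_interior :: "'b::euclidean_space set \<Rightarrow> 'b set" where
  "monoid_interior M = M \<inter> rel_interior (convex_cone hull M)"

text \<open>For a normal affine monoid \<open>M\<close>, the ideal of the monoid algebra spanned by the monomials of
  \<open>monoid_interior M\<close> is the canonical module; the algebra is Gorenstein iff this
  ideal is principal, generated by the monomial of some \<open>x\<close> as below.\<close>

definition canonical_generator :: "'b::euclidean_space set \<Rightarrow> 'b \<Rightarrow> bool" where
  "canonical_generator M x \<longleftrightarrow>
     x \<in> monoid_interior M \<and> monoid_interior M = {x + y | y. y \<in> M}"

definition gorenstein_monoid :: "'b::euclidean_space set \<Rightarrow> bool" where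
  "gorenstein_monoid M \<longleftrightarrow> (\<exists>x. canonical_generator M x)"


subsection \<open>The monoid of the cut polytope\<close>

text \<open>The edges \<open>e\<^sub>1, \<dots>, e\<^sub>m\<close> are enumerated by a finite index type \<open>'m\<close> with
  \<open>m = CARD('m)\<close>, so that \<open>m \<ge> 1\<close>.\<close>

definition cut_vector :: "('m::finite \<Rightarrow> 'a set) \<Rightarrow> 'a set \<Rightarrow> real ^ 'm" where
  "cut_vector e A = (\<chi> i. if card (A \<inter> e i) = 1 then 1 else 0)"

definition cut_monoid :: "'a set \<Rightarrow> ('m::finite \<Rightarrow> 'a set) \<Rightarrow> ((real ^ 'm) \<times> real) set" where
  "cut_monoid V e = monoid_closure {(cut_vector e A, 1) | A. A \<subseteq> V}"

text \<open>The polytope itself is the convex hull of the cut vectors; it is called normal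
  (respectively Gorenstein) if its monoid is.\<close>

definition cut_polytope_normal :: "'a set \<Rightarrow> ('m::finite \<Rightarrow> 'a set) \<Rightarrow> bool" where
  "cut_polytope_normal V e \<longleftrightarrow> normal_monoid (cut_monoid V e)"

definition cut_polytope_gorenstein :: "'a set \<Rightarrow> ('m::finite \<Rightarrow> 'a set) \<Rightarrow> bool" where
  "cut_polytope_gorenstein V e \<longleftrightarrow> gorenstein_monoid (cut_monoid V e)"

end

theory Submission
  imports Defs
begin

text \<open>Write \<open>c = (1,\<dots>,1,2)\<close>. The sum of all generators \<open>(\<delta>\<^sub>A,1)\<close> is a positive multiple of \<open>c\<close>, so
  every positive multiple of \<open>c\<close> is a relative interior point of the cone. If a multiple \<open>kc\<close>
  lies in the monoid, then \<open>kc = x + y\<close> with \<open>y\<close> in the monoid, which bounds \<open>x\<close> from above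
  coordinatewise. Conversely, a linear functional with values in the natural numbers on the
  generators, not vanishing identically, is at least 1 at \<open>x\<close>. In case (i), \<open>c\<close> is the sum of the
  cut points of the empty set and of a colour class, and the functionals \<open>x\<^sub>e\<close> and \<open>t - x\<^sub>e\<close>
  (\<open>t\<close> the last coordinate) force \<open>x = c\<close>. In case (ii), \<open>2c\<close> lies in the group and hence, by
  normality, in the monoid; every edge lies in a triangle, and the triangle functionals
  \<open>(x\<^sub>e + x\<^sub>f - x\<^sub>g)/2\<close> and \<open>t - (x\<^sub>e + x\<^sub>f + x\<^sub>g)/2\<close>, integral because a cut meets a
  triangle in an even number of edges, force \<open>x = 2c\<close>.\<close>

subsection \<open>Interiors of affine monoids\<close>

lemma sum_in_monoid_closure:
  assumes "finite I" "\<And>i. i \<in> I \<Longrightarrow> f i \<in> monoid_closure S"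
  shows "(\<Sum>i\<in>I. f i) \<in> monoid_closure S"
  using assms by (induction I rule: finite_induct) (auto intro: monoid_closure.intros)

lemma sum_in_group_closure:
  assumes "finite I" "\<And>i. i \<in> I \<Longrightarrow> f i \<in> group_closure S"
  shows "(\<Sum>i\<in>I. f i) \<in> group_closure S"
  using assms by (induction I rule: finite_induct) (auto intro: group_closure_add)

lemma linear_Nats_monoid_closure:
  assumes "linear f" "\<And>s. s \<in> S \<Longrightarrow> f s \<in> \<nat>" "y \<in> monoid_closure S"
  shows "f y \<in> (\<nat> :: real set)"
  using assms(3) by induction (auto simp: assms linear_0 linear_add)

text \<open>\<open>f\<close> is nonnegative on the cone. If it vanished at \<open>x\<close>,
  prolonging the segment from \<open>z\<close> slightly beyond \<open>x\<close> would reach a cone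
  point where \<open>f\<close> is negative. So \<open>f x\<close> is positive, and it is a natural
  number.\<close>

lemma linear_ge_1_monoid_interior:
  fixes f :: "'b::euclidean_space \<Rightarrow> real"
  assumes f: "linear f" and S: "\<And>s. s \<in> S \<Longrightarrow> f s \<in> \<nat>"
    and z: "z \<in> monoid_closure S" "f z \<noteq> 0"
    and x: "x \<in> monoid_interior (monoid_closure S)"
  shows "1 \<le> f x"
proof -
  let ?K = "convex_cone hull (monoid_closure S)"
  have nonneg: "0 \<le> f y" if "y \<in> ?K" for y
  proof -
    have "?K \<subseteq> {y. 0 \<le> f y}"
    proof (rule hull_minimal)
      show "monoid_closure S \<subseteq> {y. 0 \<le> f y}"
        using linear_Nats_monoid_closure[OF f S]
        by (force elim!: Nats_cases)
      show "convex_cone {y. 0 \<le> f y}"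
        using f by (simp add: convex_cone_iff linear_0 linear_add linear_cmul)
    qed
    with that show ?thesis by blast
  qed
  have zK: "z \<in> ?K"
    using z(1) by (rule hull_inc)
  then have "0 < f z"
    using nonneg[of z] z(2) by simp
  obtain r where r: "r > 1" "(1 - r) *\<^sub>R z + r *\<^sub>R x \<in> ?K"
    using x zK convex_rel_interior_iff[OF convex_convex_cone_hull convex_cone_hull_nonempty]
    unfolding monoid_interior_def by blast
  have "0 \<le> (1 - r) * f z + r * f x"
    using nonneg[OF r(2)] f by (simp add: linear_add linear_cmul)
  moreover have "(1 - r) * f z < 0"
    using r(1) \<open>0 < f z\<close> by (simp add: mult_neg_pos)
  ultimately have "0 < r * f x" by linarith
  then have "0 < f x"
    using r(1) by (simp add: zero_less_mult_iff)
  moreover have "f x \<in> \<nat>"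
    using x linear_Nats_monoid_closure[OF f S] by (simp add: monoid_interior_def)
  ultimately show ?thesis
    by (auto elim!: Nats_cases)
qed

text \<open>A small positive multiple of any cone point can be subtracted from the scaled sum
  without leaving the cone: this holds for each generator and passes to conic combinations. It
  yields the prolongation criterion for relative interior points.\<close>

lemma scaled_sum_in_rel_interior_cone:
  fixes g :: "'i \<Rightarrow> 'b::euclidean_space"
  assumes "finite I" "k > 0"
  shows "k *\<^sub>R (\<Sum>i\<in>I. g i) \<in> rel_interior (convex_cone hull (monoid_closure (g ` I)))"
    (is "?c \<in> rel_interior ?K")
proof -
  have cK: "k *\<^sub>R (\<Sum>i\<in>J. g i) \<in> ?K" if "J \<subseteq> I" for J
    using that assms finite_subset[OF that]
    by (intro convex_cone_hull_mul hull_inc sum_in_monoid_closure)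
      (auto intro!: monoid_closure.base)
  define P where "P = {s. \<exists>d>0. ?c - d *\<^sub>R s \<in> ?K}"
  have zeroP: "0 \<in> P"
    using cK[of I] by (auto simp: P_def intro: exI[of _ 1])
  have addP: "s + t \<in> P" if "s \<in> P" "t \<in> P" for s t
  proof -
    obtain a b where ab: "a > 0" "?c - a *\<^sub>R s \<in> ?K" "b > 0" "?c - b *\<^sub>R t \<in> ?K"
      using \<open>s \<in> P\<close> \<open>t \<in> P\<close> unfolding P_def by blast
    \<comment> \<open>The weights add up to 1 and give \<open>s\<close> and \<open>t\<close> the
      same coefficient.\<close>
    have "(b / (a + b)) *\<^sub>R (?c - a *\<^sub>R s) + (a / (a + b)) *\<^sub>R (?c - b *\<^sub>R t) \<in> ?K"
      using ab by (intro convex_cone_hull_add convex_cone_hull_mul) auto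
    also have "(b / (a + b)) *\<^sub>R (?c - a *\<^sub>R s) + (a / (a + b)) *\<^sub>R (?c - b *\<^sub>R t)
      = (b / (a + b) + a / (a + b)) *\<^sub>R ?c - (a * b / (a + b)) *\<^sub>R (s + t)"
      by (simp add: algebra_simps)
    also have "b / (a + b) + a / (a + b) = 1"
      using ab by (simp flip: add_divide_distrib add: add.commute)
    finally have "?c - (a * b / (a + b)) *\<^sub>R (s + t) \<in> ?K" by simp
    moreover have "a * b / (a + b) > 0" using ab by simp
    ultimately show ?thesis unfolding P_def by blast
  qed
  have scaleP: "r *\<^sub>R s \<in> P" if "s \<in> P" "0 \<le> r" for s r
  proof (cases "r = 0")
    case True
    then show ?thesis using zeroP by simp
  next
    case False
    obtain a where "a > 0" "?c - a *\<^sub>R s \<in> ?K"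
      using \<open>s \<in> P\<close> unfolding P_def by blast
    then have "a / r > 0" "?c - (a / r) *\<^sub>R (r *\<^sub>R s) \<in> ?K"
      using False that by auto
    then show ?thesis unfolding P_def by blast
  qed
  have gP: "g i \<in> P" if "i \<in> I" for i
  proof -
    have "?c - k *\<^sub>R g i = k *\<^sub>R (\<Sum>j\<in>I - {i}. g j)"
      using that assms by (simp add: sum.remove[of I i] algebra_simps)
    then show ?thesis
      using cK[of "I - {i}"] assms unfolding P_def by auto
  qed
  have "y \<in> P" if "y \<in> monoid_closure (g ` I)" for y
    using that by induction (auto intro: addP zeroP gP)
  then have KP: "?K \<subseteq> P"
    using zeroP addP scaleP by (intro hull_minimal) (auto simp: convex_cone_iff)
  have "\<exists>r>1. (1 - r) *\<^sub>R s + r *\<^sub>R ?c \<in> ?K" if sK: "s \<in> ?K" for s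
  proof -
    obtain d where d: "d > 0" "?c - d *\<^sub>R s \<in> ?K"
      using KP sK unfolding P_def by blast
    \<comment> \<open>Adding \<open>d\<close> times \<open>?c\<close> makes the coefficients
      \<open>-d\<close> and \<open>1 + d\<close> sum to 1, so \<open>r = 1 + d\<close>.\<close>
    have "(?c - d *\<^sub>R s) + d *\<^sub>R ?c \<in> ?K"
      by (intro convex_cone_hull_add[OF d(2)] convex_cone_hull_mul cK[of I] order.refl less_imp_le[OF d(1)])
    then have "(1 - (1 + d)) *\<^sub>R s + (1 + d) *\<^sub>R ?c \<in> ?K"
      by (simp add: algebra_simps)
    then show ?thesis
      using d(1) by (intro exI[of _ "1 + d"]) simp
  qed
  then show ?thesis
    using convex_rel_interior_iff[OF convex_convex_cone_hull convex_cone_hull_nonempty] by blast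
qed


subsection \<open>Cut points\<close>

abbreviation cut_point :: "('m::finite \<Rightarrow> 'a set) \<Rightarrow> 'a set \<Rightarrow> (real ^ 'm) \<times> real" where
  "cut_point e A \<equiv> (cut_vector e A, 1)"

abbreviation (input) cut_centre :: "(real ^ 'm::finite) \<times> real" where
  "cut_centre \<equiv> (\<chi> i. 1, 2)"

lemma cut_monoid_eq: "cut_monoid V e = monoid_closure (cut_point e ` Pow V)"
  unfolding cut_monoid_def by (rule arg_cong[where f = monoid_closure]) auto

lemma cut_vector_pair:
  assumes "e i = {u, v}" "u \<noteq> v"
  shows "cut_vector e A $ i = (if u \<in> A \<longleftrightarrow> v \<in> A then 0 else 1)"
proof -
  have "A \<inter> {u, v} = (if u \<in> A then {u} else {}) \<union> (if v \<in> A then {v} else {})"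
    by auto
  then show ?thesis
    using assms by (auto simp: cut_vector_def)
qed

lemma simple_graph_edgeE:
  assumes "simple_graph V E" "d \<in> E"
  obtains u v where "d = {u, v}" "u \<noteq> v" "u \<in> V" "v \<in> V"
  using assms unfolding simple_graph_def by (metis card_2_iff insert_subset)

lemma indexed_edgeE:
  assumes "simple_graph V E" "range e \<subseteq> E"
  obtains u v where "e i = {u, v}" "u \<noteq> v" "u \<in> V" "v \<in> V"
proof (rule simple_graph_edgeE[OF assms(1)])
  show "e i \<in> E" using assms(2) by blast
qed (rule that)

text \<open>Each edge is cut by exactly half of the subsets of \<open>V\<close>. The factor 2 on the
  left avoids the exponent \<open>card V - 1\<close>.\<close>

lemma sum_cut_points:
  assumes G: "simple_graph V E" "range e \<subseteq> E"
  shows "2 *\<^sub>R (\<Sum>A\<in>Pow V. cut_point e A) = 2 ^ card V *\<^sub>R (cut_centre :: (real ^ 'm::finite) \<times> real)"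
proof -
  have fin: "finite V"
    using G by (simp add: simple_graph_def)
  have half: "2 * (\<Sum>A\<in>Pow V. cut_vector e A $ i) = 2 ^ card V" for i
  proof -
    obtain u v where uv: "e i = {u, v}" "u \<noteq> v" "u \<in> V" "v \<in> V"
      by (rule indexed_edgeE[OF G, of i])
    define s where "s A = (if u \<in> A then A - {u} else insert u A)" for A
    \<comment> \<open>Moving \<open>u\<close> to the other side of the cut toggles the coordinate \<open>i\<close>.\<close>
    have "(\<Sum>A\<in>Pow V. cut_vector e A $ i) = (\<Sum>A\<in>Pow V. 1 - cut_vector e A $ i)"
      by (rule sum.reindex_bij_witness[of _ s s])
        (use uv in \<open>auto simp: s_def cut_vector_pair split: if_splits\<close>)
    also have "\<dots> = 2 ^ card V - (\<Sum>A\<in>Pow V. cut_vector e A $ i)"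
      using fin by (simp add: sum_subtractf card_Pow)
    finally show ?thesis by simp
  qed
  show ?thesis
    by (rule prod_eqI)
      (use fin in \<open>auto simp: vec_eq_iff fst_sum snd_sum half card_Pow\<close>)
qed

lemma cut_centre_in_rel_interior:
  assumes G: "simple_graph V E" "range e \<subseteq> E" and k: "k > 0"
  shows "k *\<^sub>R (cut_centre :: (real ^ 'm::finite) \<times> real)
    \<in> rel_interior (convex_cone hull (cut_monoid V e))"
proof -
  have "finite V" using G by (simp add: simple_graph_def)
  have "k *\<^sub>R cut_centre = (k / 2 ^ card V) *\<^sub>R (2 ^ card V *\<^sub>R (cut_centre :: (real ^ 'm) \<times> real))"
    by (simp del: scaleR_Pair)
  also have "\<dots> = (2 * k / 2 ^ card V) *\<^sub>R (\<Sum>A\<in>Pow V. cut_point e A)"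
    unfolding sum_cut_points[OF G, symmetric] by (simp del: scaleR_Pair)
  finally show ?thesis
    using scaled_sum_in_rel_interior_cone[of "Pow V" "2 * k / 2 ^ card V" "cut_point e"] k \<open>finite V\<close>
    by (simp add: cut_monoid_eq)
qed

lemma canonical_generator_cut_centre:
  assumes G: "simple_graph V E" "range e \<subseteq> E" and k: "k > 0"
    and M: "k *\<^sub>R cut_centre \<in> cut_monoid V e"
    and x: "canonical_generator (cut_monoid V e) x"
  shows "fst x $ i \<le> k" "snd x \<le> 2 * k"
proof -
  have "k *\<^sub>R cut_centre \<in> monoid_interior (cut_monoid V e)"
    using M cut_centre_in_rel_interior[OF G k] by (simp add: monoid_interior_def)
  then obtain y where y: "y \<in> cut_monoid V e" "k *\<^sub>R cut_centre = x + y"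
    using x unfolding canonical_generator_def by blast
  have "0 \<le> fst y $ j \<and> 0 \<le> snd y" for j
    using y(1) unfolding cut_monoid_eq
    by induction (auto simp: cut_vector_def)
  moreover have "k = fst x $ j + fst y $ j" "2 * k = snd x + snd y" for j
    using arg_cong[OF y(2), of "\<lambda>z. fst z $ j"] arg_cong[OF y(2), of snd] by auto
  ultimately show "fst x $ i \<le> k" "snd x \<le> 2 * k"
    by (metis add_increasing2 le_add_same_cancel1)+
qed

section \<open>Lower bounds from integral functionals\<close>

text \<open>The sum of all cut points is a positive multiple of the centre, so it suffices to test
  at the centre that \<open>f\<close> is not identically zero on the monoid.\<close>

lemma linear_ge_1_cut_interior:
  fixes f :: "(real ^ 'm::finite) \<times> real \<Rightarrow> real"
  assumes G: "simple_graph V E" "range e \<subseteq> E"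
    and f: "linear f" "\<And>A. A \<subseteq> V \<Longrightarrow> f (cut_point e A) \<in> \<nat>" "f cut_centre \<noteq> 0"
    and x: "x \<in> monoid_interior (cut_monoid V e)"
  shows "1 \<le> f x"
proof (rule linear_ge_1_monoid_interior[OF f(1)])
  show "f s \<in> \<nat>" if "s \<in> cut_point e ` Pow V" for s
    using that f(2) by auto
  show "(\<Sum>A\<in>Pow V. cut_point e A) \<in> monoid_closure (cut_point e ` Pow V)"
    using G(1) by (intro sum_in_monoid_closure) (auto simp: simple_graph_def intro: monoid_closure.base)
  have "2 * f (\<Sum>A\<in>Pow V. cut_point e A) = 2 ^ card V * f cut_centre"
    using arg_cong[OF sum_cut_points[OF G], of f] f(1)
    by (simp add: linear_cmul del: scaleR_Pair)
  then show "f (\<Sum>A\<in>Pow V. cut_point e A) \<noteq> 0"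
    using f(3) by auto
  show "x \<in> monoid_interior (monoid_closure (cut_point e ` Pow V))"
    using x by (simp add: cut_monoid_eq)
qed

lemma cut_interior_edge_bounds:
  assumes G: "simple_graph V E" "range e \<subseteq> E" and x: "x \<in> monoid_interior (cut_monoid V e)"
  shows "1 \<le> fst x $ i" "1 \<le> snd x - fst x $ i"
proof -
  show "1 \<le> fst x $ i"
    by (rule linear_ge_1_cut_interior[OF G _ _ _ x])
      (auto simp: cut_vector_def intro!: linearI)
  show "1 \<le> snd x - fst x $ i"
    by (rule linear_ge_1_cut_interior[OF G _ _ _ x, where f = "\<lambda>y. snd y - fst y $ i"])
      (auto simp: cut_vector_def algebra_simps intro!: linearI)
qed

text \<open>A cut contains 0 or 2 edges of a triangle, so the halved functionals take only the
  values 0 and 1 on cut points; both are 1/2 at the centre. The halving is what raises the bounds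
  from 1 to 2.\<close>

lemma cut_interior_triangle_bounds:
  assumes G: "simple_graph V E" "range e \<subseteq> E" and x: "x \<in> monoid_interior (cut_monoid V e)"
    and tri: "e i = {p, q}" "e j = {q, r}" "e k = {p, r}" "p \<noteq> q" "q \<noteq> r" "p \<noteq> r"
  shows "2 \<le> fst x $ i + fst x $ j - fst x $ k"
    and "2 \<le> 2 * snd x - (fst x $ i + fst x $ j + fst x $ k)"
proof -
  have "1 \<le> (fst x $ i + fst x $ j - fst x $ k) / 2"
    by (rule linear_ge_1_cut_interior[OF G _ _ _ x,
          where f = "\<lambda>y. (fst y $ i + fst y $ j - fst y $ k) / 2"])
      (auto simp: cut_vector_pair tri field_simps intro!: linearI)
  then show "2 \<le> fst x $ i + fst x $ j - fst x $ k" by simp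
  have "1 \<le> snd x - (fst x $ i + fst x $ j + fst x $ k) / 2"
    by (rule linear_ge_1_cut_interior[OF G _ _ _ x,
          where f = "\<lambda>y. snd y - (fst y $ i + fst y $ j + fst y $ k) / 2"])
      (auto simp: cut_vector_pair tri field_simps intro!: linearI)
  then show "2 \<le> 2 * snd x - (fst x $ i + fst x $ j + fst x $ k)" by argo
qed

section \<open>Multiples of the centre in the monoid and its group\<close>

lemma cut_centre_in_cut_monoid_bipartite:
  assumes "bipartite_graph V E" "range e \<subseteq> E"
  shows "cut_centre \<in> cut_monoid V e"
proof -
  obtain X Y where XY: "X \<union> Y = V" "X \<inter> Y = {}" "\<forall>d\<in>E. \<exists>u\<in>X. \<exists>v\<in>Y. d = {u, v}"
    using assms(1) unfolding bipartite_graph_def by (elim exE conjE) (rule that)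
  have "cut_vector e X $ i = 1" for i
  proof -
    have "e i \<in> E" using assms(2) by blast
    then obtain u v where uv: "u \<in> X" "v \<in> Y" "e i = {u, v}"
      using XY(3) by metis
    with XY(2) have "u \<noteq> v" "v \<notin> X" by auto
    with uv show ?thesis by (simp add: cut_vector_pair)
  qed
  then have "cut_centre = cut_point e X + cut_point e {}"
    by (simp add: vec_eq_iff cut_vector_def)
  moreover have "cut_point e X + cut_point e {} \<in> cut_monoid V e"
    unfolding cut_monoid_eq using XY(1)
    by (intro monoid_closure.add monoid_closure.base) auto
  ultimately show ?thesis by metis
qed

lemma twice_cut_centre_in_cut_group:
  assumes G: "simple_graph V E" "range e \<subseteq> E" and e: "inj e"
  shows "2 *\<^sub>R cut_centre \<in> group_closure (cut_monoid V e)"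
proof -
  let ?L = "group_closure (cut_monoid V e)"
  have cut: "cut_point e A \<in> ?L" if "A \<subseteq> V" for A
    using that by (auto simp: cut_monoid_eq intro!: group_closure.base monoid_closure.base)
  have unit: "(axis i 2, 0) \<in> ?L" for i
  proof -
    obtain u v where uv: "e i = {u, v}" "u \<noteq> v" "u \<in> V" "v \<in> V"
      by (rule indexed_edgeE[OF G, of i])
    \<comment> \<open>In this inclusion-exclusion an edge leaving \<open>{u, v}\<close> cancels and
      an edge joining \<open>u\<close> to \<open>v\<close> counts twice. By injectivity of
      \<open>e\<close>, only the index \<open>i\<close> has that edge.\<close>
    have "cut_vector e {u} $ j + cut_vector e {v} $ j - cut_vector e {u, v} $ j = axis i 2 $ j" for j
    proof -
      obtain p q where pq: "e j = {p, q}" "p \<noteq> q"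
        by (rule indexed_edgeE[OF G, of j])
      show ?thesis
      proof (cases "j = i")
        case True
        then show ?thesis using uv by (simp add: cut_vector_pair)
      next
        case False
        then have "e j \<noteq> e i"
          using e by (simp add: inj_eq)
        then have "{p, q} \<noteq> {u, v}"
          unfolding pq(1) uv(1) .
        then show ?thesis
          using False uv(2) pq by (auto simp: cut_vector_pair[of e j p q] axis_def)
      qed
    qed
    \<comment> \<open>The empty cut is the point \<open>(0, 1)\<close>; subtracting it brings the
      last coordinate to 0.\<close>
    then have "(axis i 2, 0) = cut_point e {u} + cut_point e {v} - cut_point e {u, v} - cut_point e {}"
      by (simp add: vec_eq_iff cut_vector_def)
    moreover have "cut_point e {u} + cut_point e {v} - cut_point e {u, v} - cut_point e {} \<in> ?L"
      using uv by (intro group_closure.diff group_closure_add cut) auto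
    ultimately show ?thesis by metis
  qed
  have "2 *\<^sub>R cut_centre = (\<Sum>i\<in>UNIV. (axis i 2, 0)) + (\<Sum>i<4::nat. cut_point e {})"
    by (rule prod_eqI) (auto simp: fst_sum snd_sum vec_eq_iff cut_vector_def axis_def)
  also have "\<dots> \<in> ?L"
    by (intro group_closure_add sum_in_group_closure unit cut) auto
  finally show ?thesis .
qed

text \<open>Four times the sum of all cut points is \<open>2 ^ card V\<close> times the doubled
  centre, so a positive multiple of this group element lies in the monoid and normality
  applies.\<close>

lemma twice_cut_centre_in_cut_monoid:
  assumes G: "simple_graph V E" "range e \<subseteq> E" and e: "inj e" and N: "cut_polytope_normal V e"
  shows "2 *\<^sub>R cut_centre \<in> cut_monoid V e"
proof -
  let ?s = "\<Sum>A\<in>Pow V. cut_point e A"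
  have "?s \<in> cut_monoid V e"
    using G(1) unfolding cut_monoid_eq
    by (intro sum_in_monoid_closure) (auto simp: simple_graph_def intro: monoid_closure.base)
  then have "(?s + ?s) + (?s + ?s) \<in> cut_monoid V e"
    by (simp only: cut_monoid_eq monoid_closure.add)
  also have "(?s + ?s) + (?s + ?s) = 2 *\<^sub>R (2 *\<^sub>R ?s)"
    by (simp only: scaleR_2)
  also have "\<dots> = real (2 ^ card V) *\<^sub>R (2 *\<^sub>R cut_centre)"
    unfolding sum_cut_points[OF G] by simp
  finally show ?thesis
    using N twice_cut_centre_in_cut_group[OF G e]
    unfolding cut_polytope_normal_def normal_monoid_def
    by (metis zero_less_numeral zero_less_power)
qed


subsection \<open>Triangles in chordal graphs\<close>

text \<open>Allows any prescribed edge of a cycle to be made its closing edge.\<close>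

lemma is_cycle_rotate:
  assumes "is_cycle E vs"
  shows "is_cycle E (rotate k vs)"
proof -
  have "cycle_edges (rotate k vs) \<subseteq> cycle_edges vs"
  proof
    fix d assume "d \<in> cycle_edges (rotate k vs)"
    then obtain i where i: "i < length vs"
      "d = {rotate k vs ! i, rotate k vs ! (Suc i mod length vs)}"
      by (auto simp: cycle_edges_def)
    then have "length vs > 0" by linarith
    then have "d = {vs ! ((k + i) mod length vs), vs ! (Suc ((k + i) mod length vs) mod length vs)}"
      using i by (simp add: nth_rotate mod_simps)
    then show "d \<in> cycle_edges vs"
      using \<open>length vs > 0\<close> unfolding cycle_edges_def by (auto intro!: exI[of _ "(k + i) mod length vs"])
  qed
  then show ?thesis
    using assms by (auto simp: is_cycle_def)
qed

text \<open>A chord shortens the cycle on the side that keeps the closing edge \<open>{last vs, hd vs}\<close>.\<close>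

lemma chordal_closing_edge_in_triangle:
  assumes G: "simple_graph V E" "chordal_graph E" and "is_cycle E vs"
  shows "\<exists>w. w \<noteq> hd vs \<and> w \<noteq> last vs \<and> {last vs, w} \<in> E \<and> {hd vs, w} \<in> E"
  using assms(3)
proof (induction "length vs" arbitrary: vs rule: less_induct)
  case less
  define n where "n = length vs"
  have n: "3 \<le> n" and dist: "distinct vs" and sub: "cycle_edges vs \<subseteq> E"
    using less.prems by (auto simp: is_cycle_def n_def)
  have step: "{vs ! i, vs ! Suc i} \<in> cycle_edges vs" if "Suc i < n" for i
    using that unfolding cycle_edges_def n_def by (auto intro!: exI[of _ i])
  have closing: "{vs ! (n - 1), vs ! 0} \<in> cycle_edges vs"
  proof -
    have "n - 1 < n" "Suc (n - 1) mod n = 0" using n by simp_all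
    then show ?thesis unfolding cycle_edges_def n_def[symmetric] by (metis (mono_tags, lifting) mem_Collect_eq)
  qed
  have hd_last: "hd vs = vs ! 0" "last vs = vs ! (n - 1)"
    using n by (auto simp: n_def hd_conv_nth last_conv_nth simp flip: length_greater_0_conv)
  show ?case
  proof (cases "n = 3")
    case True
    have "{vs ! 0, vs ! 1} \<in> E" "{vs ! 1, vs ! 2} \<in> E"
      using step[of 0] step[of 1] sub True by (auto simp: numeral_2_eq_2)
    moreover have "vs ! 1 \<noteq> vs ! 0" "vs ! 1 \<noteq> vs ! 2"
      using dist True by (auto simp: nth_eq_iff_index_eq n_def)
    ultimately show ?thesis
      unfolding hd_last using True by (intro exI[of _ "vs ! 1"]) (auto simp: insert_commute)
  next
    case False
    then have "\<not> induced_cycle E vs"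
      using G(2) by (auto simp: chordal_graph_def n_def)
    moreover have "cycle_edges vs \<subseteq> {d \<in> E. d \<subseteq> set vs}"
    proof -
      have "Suc i mod length vs < length vs" if "i < length vs" for i
        using that by (intro mod_less_divisor) linarith
      then have "\<Union> (cycle_edges vs) \<subseteq> set vs"
        by (auto simp: cycle_edges_def)
      with sub show ?thesis by blast
    qed
    ultimately obtain d where d: "d \<in> E" "d \<subseteq> set vs" "d \<notin> cycle_edges vs"
      using less.prems unfolding induced_cycle_def by blast
    obtain u v where uv: "d = {u, v}" "u \<noteq> v"
      using simple_graph_edgeE[OF G(1) d(1)] by metis
    obtain i j where ij: "i < j" "j < n" "d = {vs ! i, vs ! j}"
    proof -
      obtain a b where "a < n" "b < n" "u = vs ! a" "v = vs ! b"
        using d(2) uv by (auto simp: in_set_conv_nth n_def)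
      then show thesis
        using that[of a b] that[of b a] uv by (cases a b rule: linorder_cases) (auto simp: insert_commute)
    qed
    \<comment> \<open>A chord joins no cyclically consecutive positions. This first exclusion makes
      the shortened cycle strictly shorter, the second leaves it at least 3 vertices.\<close>
    have "j \<noteq> Suc i"
      using d(3) ij step[of i] by auto
    have "\<not> (i = 0 \<and> j = n - 1)"
      using d(3) ij closing by (auto simp: insert_commute)
    define ws where "ws = take (Suc i) vs @ drop j vs"
    have len: "length ws = Suc i + (n - j)"
      using ij by (simp add: ws_def n_def)
    have nth_ws: "ws ! k = (if k \<le> i then vs ! k else vs ! (k - Suc i + j))" if "k < length ws" for k
      using that ij by (auto simp: ws_def nth_append n_def less_Suc_eq_le add.commute)
    have "cycle_edges ws \<subseteq> E"
    proof
      fix f assume "f \<in> cycle_edges ws"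
      then obtain k where k: "k < length ws" "f = {ws ! k, ws ! (Suc k mod length ws)}"
        by (auto simp: cycle_edges_def)
      \<comment> \<open>Edges of \<open>ws\<close>: before the chord, the chord itself, after it,
        and the closing edge.\<close>
      consider "k < i" | "k = i" | "i < k" "Suc k < length ws" | "Suc k = length ws"
        using k(1) by linarith
      then show "f \<in> E"
      proof cases
        case 1
        then show ?thesis
          using k len ij nth_ws[of k] nth_ws[of "Suc k"] step[of k] sub by auto
      next
        case 2
        then have "f = {vs ! i, vs ! j}"
          using k len ij by (simp add: nth_ws)
        then show ?thesis using d(1) ij(3) by simp
      next
        case 3
        then have "f = {vs ! (k - Suc i + j), vs ! Suc (k - Suc i + j)}"
          using k by (simp add: nth_ws Suc_diff_Suc Suc_diff_le)
        moreover have "Suc (k - Suc i + j) < n"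
          using 3 len ij by linarith
        ultimately show ?thesis using step sub by blast
      next
        case 4
        then have "k - Suc i + j = n - 1" "\<not> k \<le> i"
          using len ij by linarith+
        moreover have "ws ! 0 = vs ! 0"
          using nth_ws[of 0] len by simp
        ultimately have "f = {vs ! (n - 1), vs ! 0}"
          using k 4 nth_ws[of k] by simp
        then show ?thesis using closing sub by blast
      qed
    qed
    moreover have "distinct ws"
      using dist ij by (simp add: ws_def set_take_disj_set_drop_if_distinct)
    moreover have "3 \<le> length ws"
      using len ij \<open>\<not> (i = 0 \<and> j = n - 1)\<close> by linarith
    ultimately have "is_cycle E ws"
      by (simp add: is_cycle_def)
    moreover have "length ws < length vs"
      using len ij \<open>j \<noteq> Suc i\<close> by (simp add: n_def)
    moreover have "hd ws = hd vs" "last ws = last vs"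
      using ij by (auto simp: ws_def n_def hd_append)
    ultimately show ?thesis
      using less.hyps by metis
  qed
qed

lemma chordal_bridgeless_edge_in_triangle:
  assumes G: "simple_graph V E" "chordal_graph E" "bridgeless E" and d: "d \<in> E"
  obtains p q r where "d = {p, q}" "{q, r} \<in> E" "{p, r} \<in> E" "p \<noteq> q" "q \<noteq> r" "p \<noteq> r"
proof -
  obtain vs where vs: "is_cycle E vs" "d \<in> cycle_edges vs"
    using G(3) d unfolding bridgeless_def is_bridge_def by blast
  then obtain k where k: "k < length vs" "d = {vs ! k, vs ! (Suc k mod length vs)}"
    by (auto simp: cycle_edges_def)
  \<comment> \<open>This rotation puts \<open>vs ! k\<close> last and its cyclic successor first, so
    \<open>d\<close> becomes the closing edge.\<close>
  define ws where "ws = rotate (Suc k) vs"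
  have ne: "ws \<noteq> []" "length vs > 0" using k by (auto simp: ws_def)
  have "ws ! 0 = vs ! (Suc k mod length vs)"
    using nth_rotate[of 0 vs "Suc k"] ne by (simp add: ws_def)
  moreover have "ws ! (length vs - 1) = vs ! k"
    using nth_rotate[of "length vs - 1" vs "Suc k"] k ne by (simp add: ws_def)
  ultimately have d_eq: "d = {hd ws, last ws}"
    using k ne by (auto simp: hd_conv_nth last_conv_nth ws_def)
  have "is_cycle E ws"
    unfolding ws_def by (rule is_cycle_rotate[OF vs(1)])
  then obtain w where "w \<noteq> hd ws" "w \<noteq> last ws" "{last ws, w} \<in> E" "{hd ws, w} \<in> E"
    using chordal_closing_edge_in_triangle[OF G(1,2)] by blast
  moreover have "hd ws \<noteq> last ws"
    using simple_graph_edgeE[OF G(1) d] d_eq by (metis doubleton_eq_iff insert_absorb2)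
  ultimately show thesis
    using that[of "hd ws" "last ws" w] d_eq by auto
qed

section \<open>Squeezing the generator between the bounds\<close>

theorem theorem5p2:
  fixes V :: "'a set" and E :: "'a set set" and e :: "'m::finite \<Rightarrow> 'a set"
    and x :: "(real ^ 'm) \<times> real"
  assumes "simple_graph V E"
    and "bij_betw e UNIV E"
    and "cut_polytope_normal V e"
    and "cut_polytope_gorenstein V e"
    and "canonical_generator (cut_monoid V e) x"
  shows "(bipartite_graph V E \<and> \<not> (\<exists>vs. induced_cycle E vs \<and> 6 \<le> length vs)
            \<longrightarrow> x = ((\<chi> i. 1), 2))
       \<and> (bridgeless E \<and> chordal_graph E \<longrightarrow> x = ((\<chi> i. 2), 4))"
proof (intro conjI impI)
  have e: "range e = E" "range e \<subseteq> E" "inj e"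
    using assms(2) by (auto simp: bij_betw_def)
  note G = assms(1) e(2)
  have x: "x \<in> monoid_interior (cut_monoid V e)"
    using assms(5) unfolding canonical_generator_def by blast
  show "x = ((\<chi> i. 1), 2)"
    if "bipartite_graph V E \<and> \<not> (\<exists>vs. induced_cycle E vs \<and> 6 \<le> length vs)"
  proof -
    have "1 *\<^sub>R cut_centre \<in> cut_monoid V e"
      using that cut_centre_in_cut_monoid_bipartite[OF _ e(2)] by simp
    from canonical_generator_cut_centre[OF G zero_less_one this assms(5)]
    have upper: "fst x $ i \<le> 1" "snd x \<le> 2" for i by auto
    \<comment> \<open>The chain is \<open>2 >= snd x >= 1 + fst x $ i >= 2\<close>.\<close>
    have "fst x $ i = 1" "snd x = 2" for i
      using upper(1)[of i] upper(2) cut_interior_edge_bounds[OF G x, of i] by linarith+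
    then show ?thesis
      by (intro prod_eqI) (auto simp: vec_eq_iff)
  qed
  show "x = ((\<chi> i. 2), 4)" if chordal: "bridgeless E \<and> chordal_graph E"
  proof -
    have upper: "fst x $ i \<le> 2" "snd x \<le> 4" for i
      using canonical_generator_cut_centre[OF G zero_less_numeral
          twice_cut_centre_in_cut_monoid[OF G e(3) assms(3)] assms(5)] by auto
    have "fst x $ i = 2 \<and> snd x = 4" for i
    proof -
      have "e i \<in> E" using e(1) by blast
      obtain p q r where pqr: "e i = {p, q}" "{q, r} \<in> E" "{p, r} \<in> E" "p \<noteq> q" "q \<noteq> r" "p \<noteq> r"
        by (rule chordal_bridgeless_edge_in_triangle[OF assms(1) conjunct2[OF chordal]
              conjunct1[OF chordal] \<open>e i \<in> E\<close>])
      obtain j k where jk: "e j = {q, r}" "e k = {p, r}"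
        using pqr(2,3) unfolding e(1)[symmetric] by (metis imageE)
      note bounds = cut_interior_triangle_bounds[OF G x]
      have "2 \<le> fst x $ i + fst x $ j - fst x $ k"
        "2 \<le> 2 * snd x - (fst x $ i + fst x $ j + fst x $ k)"
        using bounds[of i p q j r k] pqr jk by auto
      moreover have "2 \<le> fst x $ i + fst x $ k - fst x $ j"
        using bounds(1)[of i q p k r j] pqr jk by (auto simp: insert_commute)
      moreover have "2 \<le> fst x $ j + fst x $ k - fst x $ i"
        using bounds(1)[of j q r k p i] pqr jk by (auto simp: insert_commute)
      \<comment> \<open>The first and third bounds add up to \<open>fst x $ i >= 2\<close>. All
        three triangle inequalities together make the sum of the three coordinates at least 6, so
        the remaining bound gives \<open>2 * snd x >= 8\<close>.\<close>
      ultimately show ?thesis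
        using upper(1)[of i] upper(2) by linarith
    qed
    then show ?thesis
      by (intro prod_eqI) (auto simp: vec_eq_iff)
  qed
qed

end
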